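(* Let $K$ be a field of characteristic $0$, let $U_1$ be the associative unital $K$-algebra generated by $l_1,r_1$ with the single defining relation $r_1l_1=l_1r_1+r_1^2$, and let $R_1=K[r_1]\subseteq U_1$ be the subalgebra generated by $r_1$. If $\phi$ is a $K$-algebra automorphism of $U_1$, then there exist $\alpha\in K^*=K\setminus\{0\}$ and $h(r_1)\in R_1$ such that $$\phi(l_1)=\alpha l_1+h(r_1),\qquad \phi(r_1)=\alpha r_1.$$
   Context: Automorphisms are unital $K$-algebra automorphisms. *)

theory Defs
  imports Complex_Main "HOL-Library.Poly_Mapping"
begin

section \<open>The free associative algebra on two generators\<close>

datatype gen = L | R

text \<open>The free monoid on the two generators, written additively because the convolution
  product on \<^type>\<open>poly_mapping\<close> expects an additive (not necessarily commutative) monoid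
  of exponents. With this product, finitely supported functions from words to \<open>K\<close> form the
  free associative unital \<open>K\<close>-algebra on \<^const>\<open>L\<close> and \<^const>\<open>R\<close>.\<close>

datatype word = Word "gen list"

instantiation word :: monoid_add
begin

definition zero_word :: word where "0 = Word []"

fun plus_word :: "word \<Rightarrow> word \<Rightarrow> word" where
  "Word u + Word v = Word (u @ v)"

instance
proof
  fix a b c :: word
  show "a + b + c = a + (b + c)" by (cases a; cases b; cases c) simp
  show "0 + a = a" by (cases a) (simp add: zero_word_def)
  show "a + 0 = a" by (cases a) (simp add: zero_word_def)
qed

end

type_synonym 'k free_algebra = "word \<Rightarrow>\<^sub>0 'k"

definition free_gen :: "gen \<Rightarrow> 'k::field free_algebra" where
  "free_gen g = Poly_Mapping.single (Word [g]) 1"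


section \<open>Two-sided ideals, subalgebras and automorphisms\<close>

definition two_sided_ideal :: "'a::ring_1 set \<Rightarrow> bool" where
  "two_sided_ideal I \<longleftrightarrow>
     0 \<in> I \<and> (\<forall>x\<in>I. \<forall>y\<in>I. x + y \<in> I) \<and> (\<forall>x\<in>I. \<forall>a b. a * x * b \<in> I)"

definition unital_subalgebra :: "('k::field \<Rightarrow> 'a::ring_1 \<Rightarrow> 'a) \<Rightarrow> 'a set \<Rightarrow> bool" where
  "unital_subalgebra scale S \<longleftrightarrow>
     1 \<in> S \<and> (\<forall>x\<in>S. \<forall>y\<in>S. x + y \<in> S \<and> x * y \<in> S) \<and> (\<forall>c. \<forall>x\<in>S. scale c x \<in> S)"

definition algebra_automorphism ::
  "('k::field \<Rightarrow> 'a::ring_1 \<Rightarrow> 'a) \<Rightarrow> ('a \<Rightarrow> 'a) \<Rightarrow> bool" where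
  "algebra_automorphism scale \<phi> \<longleftrightarrow>
     bij \<phi> \<and> Vector_Spaces.linear scale scale \<phi> \<and> \<phi> 1 = 1 \<and> (\<forall>x y. \<phi> (x * y) = \<phi> x * \<phi> y)"


section \<open>The algebra \<open>U\<^sub>1\<close>\<close>

definition U1_ideal :: "'k::field free_algebra set" where
  "U1_ideal = two_sided_ideal hull
     {free_gen R * free_gen L - (free_gen L * free_gen R + free_gen R ^ 2)}"

lemma two_sided_ideal_U1_ideal: "two_sided_ideal U1_ideal"
  unfolding U1_ideal_def by (rule hull_in) (simp add: two_sided_ideal_def)

lemma U1_ideal_0: "0 \<in> U1_ideal"
  and U1_ideal_add: "x \<in> U1_ideal \<Longrightarrow> y \<in> U1_ideal \<Longrightarrow> x + y \<in> U1_ideal"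
  and U1_ideal_mult: "x \<in> U1_ideal \<Longrightarrow> a * x * b \<in> U1_ideal"
  using two_sided_ideal_U1_ideal by (auto simp: two_sided_ideal_def)

lemma U1_ideal_mult_left: "x \<in> U1_ideal \<Longrightarrow> a * x \<in> U1_ideal"
  using U1_ideal_mult[of x a 1] by simp

lemma U1_ideal_mult_right: "x \<in> U1_ideal \<Longrightarrow> x * b \<in> U1_ideal"
  using U1_ideal_mult[of x 1 b] by simp

lemma U1_ideal_uminus: "x \<in> U1_ideal \<Longrightarrow> - x \<in> U1_ideal"
  using U1_ideal_mult_left[of x "-1"] by simp

lemma U1_ideal_diff: "x \<in> U1_ideal \<Longrightarrow> y \<in> U1_ideal \<Longrightarrow> x - y \<in> U1_ideal"
  using U1_ideal_add[of x "- y"] U1_ideal_uminus[of y] by simp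

text \<open>Taking the constant term kills the defining relation, so \<open>U\<^sub>1\<close> will be nontrivial.\<close>

lemma word_add_eq_0_iff: "(0 :: word) = u + v \<longleftrightarrow> u = 0 \<and> v = 0"
  by (cases u; cases v) (auto simp: zero_word_def)

lemma lookup_mult_0:
  "Poly_Mapping.lookup (p * q) 0 = Poly_Mapping.lookup p 0 * Poly_Mapping.lookup q (0 :: word)"
  for p q :: "'k::field free_algebra"
proof transfer
  fix f g :: "word \<Rightarrow> 'k"
  have "(g q when 0 = l + q) = ((g q when q = 0) when l = 0)" for l q
    by (auto simp: when_def word_add_eq_0_iff)
  then have "(\<Sum>q. (g q when 0 = l + q)) = (g 0 when l = 0)" for l
    by (cases "l = 0") simp_all
  then show "prod_fun f g 0 = f 0 * g 0"
    by (simp add: prod_fun_def mult_when)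
qed

lemma U1_ideal_lookup_0:
  fixes p :: "'k::field free_algebra"
  assumes "p \<in> U1_ideal"
  shows "Poly_Mapping.lookup p 0 = 0"
proof -
  have "Poly_Mapping.lookup (free_gen g) 0 = (0 :: 'k)" for g
    by (simp add: free_gen_def lookup_single zero_word_def)
  then have "U1_ideal \<subseteq> {p :: 'k free_algebra. Poly_Mapping.lookup p 0 = 0}"
    unfolding U1_ideal_def
    by (intro hull_minimal)
      (auto simp: two_sided_ideal_def lookup_add lookup_minus lookup_mult_0 power2_eq_square)
  with assms show ?thesis by blast
qed

definition U1_rel :: "'k::field free_algebra \<Rightarrow> 'k free_algebra \<Rightarrow> bool" where
  "U1_rel p q \<longleftrightarrow> p - q \<in> U1_ideal"

lemma U1_rel_refl: "U1_rel p p"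
  by (simp add: U1_rel_def U1_ideal_0)

quotient_type (overloaded) 'k U1 = "'k::field free_algebra" / U1_rel
proof (rule equivpI)
  show "reflp (U1_rel :: 'k free_algebra \<Rightarrow> _)"
    by (rule reflpI) (rule U1_rel_refl)
  show "symp (U1_rel :: 'k free_algebra \<Rightarrow> _)"
  proof (rule sympI)
    fix p q :: "'k free_algebra"
    assume "U1_rel p q"
    then show "U1_rel q p" using U1_ideal_uminus[of "p - q"] by (simp add: U1_rel_def)
  qed
  show "transp (U1_rel :: 'k free_algebra \<Rightarrow> _)"
  proof (rule transpI)
    fix p q s :: "'k free_algebra"
    assume "U1_rel p q" "U1_rel q s"
    then show "U1_rel p s" using U1_ideal_add[of "p - q" "q - s"] by (simp add: U1_rel_def)
  qed
qed

instantiation U1 :: (field) ring_1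
begin

lift_definition zero_U1 :: "'a U1" is 0 .

lift_definition one_U1 :: "'a U1" is 1 .

lift_definition plus_U1 :: "'a U1 \<Rightarrow> 'a U1 \<Rightarrow> 'a U1" is "(+)"
  unfolding U1_rel_def using U1_ideal_add by (metis add_diff_add)

lift_definition uminus_U1 :: "'a U1 \<Rightarrow> 'a U1" is uminus
  unfolding U1_rel_def using U1_ideal_uminus by (metis minus_diff_minus)

lift_definition minus_U1 :: "'a U1 \<Rightarrow> 'a U1 \<Rightarrow> 'a U1" is "(-)"
proof -
  fix p p' q q' :: "'a free_algebra"
  assume "U1_rel p p'" "U1_rel q q'"
  moreover have "p - q - (p' - q') = (p - p') - (q - q')" by (simp add: algebra_simps)
  ultimately show "U1_rel (p - q) (p' - q')" unfolding U1_rel_def by (simp only: U1_ideal_diff)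
qed

lift_definition times_U1 :: "'a U1 \<Rightarrow> 'a U1 \<Rightarrow> 'a U1" is "(*)"
proof -
  fix p p' q q' :: "'a free_algebra"
  assume "U1_rel p p'" "U1_rel q q'"
  moreover have "p * q - p' * q' = (p - p') * q + p' * (q - q')" by (simp add: algebra_simps)
  ultimately show "U1_rel (p * q) (p' * q')"
    by (simp add: U1_rel_def U1_ideal_add U1_ideal_mult_left U1_ideal_mult_right)
qed

instance
proof
  fix a b c :: "'a U1"
  show "a + b + c = a + (b + c)" by transfer (simp add: U1_rel_refl add.assoc)
  show "a + b = b + a" by transfer (simp add: U1_rel_refl add.commute)
  show "0 + a = a" by transfer (simp add: U1_rel_refl)
  show "- a + a = 0" by transfer (simp add: U1_rel_refl)
  show "a - b = a + - b" by transfer (simp add: U1_rel_refl)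
  show "a * b * c = a * (b * c)" by transfer (simp add: U1_rel_refl mult.assoc)
  show "1 * a = a" by transfer (simp add: U1_rel_refl)
  show "a * 1 = a" by transfer (simp add: U1_rel_refl)
  show "(a + b) * c = a * c + b * c" by transfer (simp add: U1_rel_refl distrib_right)
  show "a * (b + c) = a * b + a * c" by transfer (simp add: U1_rel_refl distrib_left)
  show "(0 :: 'a U1) \<noteq> 1"
  proof (transfer, rule notI)
    assume "U1_rel (0 :: 'a free_algebra) 1"
    then have "(1 :: 'a free_algebra) \<in> U1_ideal"
      using U1_ideal_uminus[of "- 1 :: 'a free_algebra"] by (simp add: U1_rel_def)
    then have "Poly_Mapping.lookup (1 :: 'a free_algebra) 0 = 0" by (rule U1_ideal_lookup_0)
    then show False by simp
  qed
qed

end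

lift_definition scale_U1 :: "'k::field \<Rightarrow> 'k U1 \<Rightarrow> 'k U1"  (infixr \<open>*\<^sub>U\<close> 75)
  is "\<lambda>c p. Poly_Mapping.single 0 c * p"
  by (simp add: U1_rel_def U1_ideal_mult_left flip: right_diff_distrib)

lift_definition l1 :: "'k::field U1" is "free_gen L" .

lift_definition r1 :: "'k::field U1" is "free_gen R" .

lemma r1_l1: "r1 * l1 = l1 * r1 + (r1 :: 'k::field U1) ^ 2"
  unfolding power2_eq_square
  by transfer (auto simp: U1_rel_def U1_ideal_def power2_eq_square intro: hull_inc)

lemma single_0_commute: "Poly_Mapping.single 0 c * p = p * Poly_Mapping.single 0 c"
  for p :: "'k::field free_algebra"
proof (transfer fixing: c)
  fix f :: "word \<Rightarrow> 'k"
  have "prod_fun f (\<lambda>k'. c when 0 = k') k = c * f k" for k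
  proof -
    have "prod_fun f (\<lambda>k'. c when 0 = k') k = (\<Sum>l. f l * (\<Sum>q. (c when k = l + q) when 0 = q))"
      by (simp add: prod_fun_def when_commute)
    also have "\<dots> = c * f k" by (simp add: mult_when mult.commute)
    finally show ?thesis .
  qed
  moreover have "prod_fun (\<lambda>k'. c when 0 = k') f k = c * f k" for k
    by (simp add: prod_fun_def when_mult)
  ultimately show "prod_fun (\<lambda>k'. c when 0 = k') f = prod_fun f (\<lambda>k'. c when 0 = k')"
    by (simp add: fun_eq_iff)
qed

interpretation U1: vector_space "scale_U1 :: 'k::field \<Rightarrow> 'k U1 \<Rightarrow> 'k U1"
proof
  fix a b :: 'k and x y :: "'k U1"
  show "a *\<^sub>U (x + y) = a *\<^sub>U x + a *\<^sub>U y"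
    by transfer (simp add: U1_rel_refl distrib_left)
  show "(a + b) *\<^sub>U x = a *\<^sub>U x + b *\<^sub>U x"
    by transfer (simp add: U1_rel_refl distrib_right single_add)
  show "a *\<^sub>U b *\<^sub>U x = (a * b) *\<^sub>U x"
    by transfer (simp add: U1_rel_refl mult_single flip: mult.assoc)
  show "1 *\<^sub>U x = x"
    by transfer (simp add: U1_rel_refl)
qed

lemma scale_U1_mult_left: "(c *\<^sub>U x) * y = c *\<^sub>U (x * y)"
  by transfer (simp add: mult.assoc U1_rel_refl)

lemma scale_U1_mult_right: "x * (c *\<^sub>U y) = c *\<^sub>U (x * y)"
proof transfer
  fix x y :: "'a free_algebra" and c :: 'a
  have "x * (Poly_Mapping.single 0 c * y) = Poly_Mapping.single 0 c * (x * y)"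
    by (metis mult.assoc single_0_commute)
  then show "U1_rel (x * (Poly_Mapping.single 0 c * y)) (Poly_Mapping.single 0 c * (x * y))"
    by (simp add: U1_rel_refl)
qed

definition R1 :: "'k::field U1 set" where
  "R1 = unital_subalgebra scale_U1 hull {r1}"

end

theory Submission
  imports Defs "HOL-Computational_Algebra.Polynomial"
begin

text \<open>Every commutator of \<open>U\<^sub>1\<close> lies in \<open>r\<^sub>1\<^sup>2 U\<^sub>1\<close>, because \<open>r\<^sub>1\<^sup>2 = [r\<^sub>1, l\<^sub>1]\<close> is a normal element. Applied to \<open>\<phi>\<close>
  and to its inverse this shows that \<open>\<phi>(r\<^sub>1)\<^sup>2\<close> and \<open>r\<^sub>1\<^sup>2\<close> differ by a unit, that is, by a scalar. The
  degree in \<open>l\<^sub>1\<close> is additive, so \<open>\<phi>(r\<^sub>1)\<close> is a polynomial in \<open>r\<^sub>1\<close> with square \<open>c r\<^sub>1\<^sup>2\<close>, hence equal to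
  \<open>\<alpha> r\<^sub>1\<close>. The defining relation then says that \<open>\<phi>(l\<^sub>1) - \<alpha> l\<^sub>1\<close> commutes with \<open>r\<^sub>1\<close>, and in
  characteristic \<open>0\<close> the centralizer of \<open>r\<^sub>1\<close> is \<open>K[r\<^sub>1]\<close>. Degrees are available because \<open>U\<^sub>1\<close> acts on
  \<open>K[x][y]\<close> so that \<open>u \<mapsto> u \<cdot> 1\<close> inverts \<open>\<Sum>\<^sub>j f\<^sub>j(x) y\<^sup>j \<mapsto> \<Sum>\<^sub>j f\<^sub>j(r\<^sub>1) l\<^sub>1\<^sup>j\<close>.\<close>

section \<open>Generation by \<open>l\<^sub>1\<close> and \<open>r\<^sub>1\<close>\<close>

lemma free_algebra_induct [case_names single add]:
  fixes p :: "'k::field free_algebra"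
  assumes single: "\<And>w c. P (Poly_Mapping.single w c)"
    and add: "\<And>p q. P p \<Longrightarrow> P q \<Longrightarrow> P (p + q)"
  shows "P p"
proof (induction p rule: update_induct)
  case const
  show ?case using single[of 0 0] by simp
next
  case (update f a b)
  have "Poly_Mapping.update a b f = f + Poly_Mapping.single a b"
    using update(1)
    by (intro poly_mapping_eqI) (auto simp: lookup_update lookup_add lookup_single in_keys_iff when_def)
  then show ?case using add single update(3) by simp
qed

text \<open>Words span the free algebra and are products of generators, so a property closed under
  the algebra operations spreads from \<open>1\<close>, \<open>l1\<close> and
  \<open>r1\<close>.\<close>

lemma U1_induct [case_names one l1 r1 add mult scale]:
  fixes u :: "'k::field U1"
  assumes one: "P 1" and l: "P l1" and r: "P r1"
    and add: "\<And>u v. P u \<Longrightarrow> P v \<Longrightarrow> P (u + v)"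
    and mult: "\<And>u v. P u \<Longrightarrow> P v \<Longrightarrow> P (u * v)"
    and scale: "\<And>c u. P u \<Longrightarrow> P (c *\<^sub>U u)"
  shows "P u"
proof -
  have "P (abs_U1 p)" for p
  proof (induction p rule: free_algebra_induct)
    case (single w c)
    have gen: "P (abs_U1 (free_gen g))" for g
      using l r by (cases g) (simp_all add: l1.abs_eq r1.abs_eq)
    have "P (abs_U1 (Poly_Mapping.single (Word gs) 1))" for gs
    proof (induction gs)
      case Nil
      show ?case using one by (simp add: one_U1.abs_eq flip: zero_word_def)
    next
      case (Cons g gs)
      have "abs_U1 (Poly_Mapping.single (Word (g # gs)) 1) =
          abs_U1 (free_gen g) * (abs_U1 (Poly_Mapping.single (Word gs) 1) :: 'k U1)"
        by (simp add: times_U1.abs_eq free_gen_def mult_single)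
      then show ?case using mult gen Cons by simp
    qed
    then have "P (abs_U1 (Poly_Mapping.single w 1))" by (cases w) simp
    moreover have "abs_U1 (Poly_Mapping.single w c) = c *\<^sub>U abs_U1 (Poly_Mapping.single w 1)"
      by (simp add: scale_U1.abs_eq mult_single)
    ultimately show ?case using scale by simp
  next
    case (add p q)
    then show ?case using assms(4) by (simp add: plus_U1.abs_eq[symmetric])
  qed
  then show ?thesis by (rule U1.abs_induct)
qed


section \<open>The action on polynomials\<close>

text \<open>The derivation -x^2 d/dx: it is the commutator with \<open>l1\<close> on K[r1], since l1
  r1 - r1 l1 = -r1^2.\<close>

definition r_deriv :: "'k::field poly \<Rightarrow> 'k poly" where
  "r_deriv f = - ([:0, 0, 1:] * pderiv f)"

lemma r_deriv_simps [simp]: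
  "r_deriv 0 = 0"
  "r_deriv (f + g) = r_deriv f + r_deriv g"
  "r_deriv (smult c f) = smult c (r_deriv f)"
  "r_deriv (pCons a f) = pCons 0 (r_deriv f) - pCons 0 (pCons 0 f)"
  by (simp_all add: r_deriv_def pderiv_add pderiv_smult pderiv_pCons algebra_simps)

text \<open>The polynomial \<open>\<Sum>\<^sub>j f\<^sub>j y\<^sup>j\<close> with \<open>f\<^sub>j \<in> K[x]\<close> stands for the element \<open>\<Sum>\<^sub>j f\<^sub>j(r\<^sub>1) l\<^sub>1\<^sup>j\<close>;
  left multiplication by \<open>l\<^sub>1\<close> and \<open>r\<^sub>1\<close> becomes the following pair of operators.\<close>

definition l_op :: "'k::field poly poly \<Rightarrow> 'k poly poly" where
  "l_op p = pCons 0 p + map_poly r_deriv p"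

definition r_op :: "'k::field poly poly \<Rightarrow> 'k poly poly" where
  "r_op p = smult [:0, 1:] p"

lemma coeff_l_op: "coeff (l_op p) n = coeff (pCons 0 p) n + r_deriv (coeff p n)"
  by (simp add: l_op_def coeff_map_poly)

text \<open>Scalars enter as constants \<open>[:c:]\<close>, because \<open>l_op\<close>
  differentiates coefficients and so is linear over K but not over K[x].\<close>

lemma l_op_simps [simp]:
  "l_op 0 = 0"
  "l_op (p + q) = l_op p + l_op q"
  "l_op (smult [:c:] p) = smult [:c:] (l_op p)"
  by (auto simp: poly_eq_iff[of "l_op _"] coeff_l_op coeff_pCons algebra_simps split: nat.split)

lemma r_op_simps [simp]:
  "r_op 0 = 0"
  "r_op (p + q) = r_op p + r_op q"
  "r_op (smult [:c:] p) = smult [:c:] (r_op p)"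
  by (simp_all add: r_op_def smult_add_right mult.commute)

text \<open>\<open>r_deriv\<close> is a derivation sending x to -x^2; hence the operators obey the
  defining relation and the action will descend to the quotient.\<close>

lemma r_op_l_op: "r_op (l_op p) = l_op (r_op p) + r_op (r_op p)"
  by (rule poly_eqI) (auto simp: coeff_l_op r_op_def coeff_pCons algebra_simps split: nat.split)

section \<open>Extending the action from the generators to the free algebra and to
  \<open>U1\<close>\<close>

fun gen_op :: "gen \<Rightarrow> 'k::field poly poly \<Rightarrow> 'k poly poly" where
  "gen_op L = l_op"
| "gen_op R = r_op"

fun word_op :: "word \<Rightarrow> 'k::field poly poly \<Rightarrow> 'k poly poly" where
  "word_op (Word gs) v = foldr gen_op gs v"

lemma gen_op_simps [simp]:
  "gen_op g 0 = 0"
  "gen_op g (p + q) = gen_op g p + gen_op g q"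
  "gen_op g (smult [:c:] p) = smult [:c:] (gen_op g p)"
  by (cases g; simp)+

lemma word_op_plus: "word_op (u + w) v = word_op u (word_op w v)"
  by (cases u; cases w) simp

lemma word_op_simps [simp]:
  "word_op 0 v = v"
  "word_op w 0 = 0"
  "word_op w (p + q) = word_op w p + word_op w q"
  "word_op w (smult [:c:] p) = smult [:c:] (word_op w p)"
proof -
  show "word_op 0 v = v" by (simp add: zero_word_def)
  obtain gs where w: "w = Word gs" by (cases w)
  have "foldr gen_op gs 0 = 0" "foldr gen_op gs (p + q) = foldr gen_op gs p + foldr gen_op gs q"
    "foldr gen_op gs (smult [:c:] p) = smult [:c:] (foldr gen_op gs p)"
    by (induction gs) simp_all
  with w show "word_op w 0 = 0" "word_op w (p + q) = word_op w p + word_op w q"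
    "word_op w (smult [:c:] p) = smult [:c:] (word_op w p)"
    by simp_all
qed

definition free_act :: "'k::field free_algebra \<Rightarrow> 'k poly poly \<Rightarrow> 'k poly poly" where
  "free_act p v = (\<Sum>w\<in>Poly_Mapping.keys p. smult [:Poly_Mapping.lookup p w:] (word_op w v))"

lemma free_act_superset:
  assumes "finite A" "Poly_Mapping.keys p \<subseteq> A"
  shows "free_act p v = (\<Sum>w\<in>A. smult [:Poly_Mapping.lookup p w:] (word_op w v))"
  unfolding free_act_def using assms
  by (intro sum.mono_neutral_left) (auto simp: in_keys_iff)

lemma free_act_single: "free_act (Poly_Mapping.single w c) v = smult [:c:] (word_op w v)"
  by (subst free_act_superset[of "{w}"]) auto

lemma free_act_add_left: "free_act (p + q) v = free_act p v + free_act q v"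
proof -
  let ?A = "Poly_Mapping.keys p \<union> Poly_Mapping.keys q"
  have "[:a + b:] = [:a:] + [:b:]" for a b :: 'a by simp
  then show ?thesis
    using Poly_Mapping.keys_add[of p q]
    by (simp add: free_act_superset[of ?A] lookup_add smult_add_left sum.distrib del: add_pCons)
qed

lemma free_act_0_left [simp]: "free_act 0 v = 0"
  by (simp add: free_act_def)

lemma free_act_diff_left: "free_act (p - q) v = free_act p v - free_act q v"
  using free_act_add_left[of "p - q" q v] by simp

lemma free_act_add_right: "free_act p (v + w) = free_act p v + free_act p w"
  by (simp add: free_act_def smult_add_right sum.distrib)

lemma free_act_0_right [simp]: "free_act p 0 = 0"
  by (simp add: free_act_def)

lemma free_act_mult: "free_act (p * q) v = free_act p (free_act q v)"
proof (induction p rule: free_algebra_induct)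
  case (single w c)
  show ?case
    by (induction q rule: free_algebra_induct)
      (simp_all add: mult_single free_act_single word_op_plus free_act_add_left free_act_add_right
        distrib_left mult.commute)
qed (simp add: free_act_add_left distrib_right)

text \<open>The elements acting as zero form a two-sided ideal, which contains the relator by
  \<open>r_op_l_op\<close>.\<close>

lemma free_act_U1_ideal:
  fixes p :: "'k::field free_algebra"
  assumes "p \<in> U1_ideal"
  shows "free_act p v = 0"
proof -
  have gen: "free_act (free_gen g) v = (gen_op g v :: 'k poly poly)" for g v
    by (simp add: free_gen_def free_act_single one_pCons[symmetric])
  have "U1_ideal \<subseteq> {p :: 'k free_algebra. \<forall>v. free_act p v = 0}"
    unfolding U1_ideal_def
    by (intro hull_minimal)
      (auto simp: two_sided_ideal_def free_act_add_left free_act_diff_left free_act_mult gen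
        r_op_l_op power2_eq_square)
  with assms show ?thesis by blast
qed

lift_definition act :: "'k::field U1 \<Rightarrow> 'k poly poly \<Rightarrow> 'k poly poly" is free_act
proof (rule ext)
  fix p q :: "'k free_algebra" and v
  assume "U1_rel p q"
  then show "free_act p v = free_act q v"
    using free_act_U1_ideal[of "p - q" v] by (simp add: U1_rel_def free_act_diff_left)
qed

lemma act_add_left: "act (u + w) v = act u v + act w v"
  by transfer (rule free_act_add_left)

lemma act_0_left [simp]: "act 0 v = 0"
  by transfer simp

lemma act_mult: "act (u * w) v = act u (act w v)"
  by transfer (rule free_act_mult)

lemma act_scale: "act (c *\<^sub>U u) v = smult [:c:] (act u v)"
  by transfer (simp add: free_act_mult free_act_single)

lemma act_one [simp]: "act 1 v = v"
  by transfer (metis free_act_single single_one smult_1_left one_pCons word_op_simps(1))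

lemma act_l1: "act l1 v = l_op v"
  by transfer (simp add: free_gen_def free_act_single one_pCons[symmetric])

lemma act_r1: "act r1 v = r_op v"
  by transfer (simp add: free_gen_def free_act_single one_pCons[symmetric])


section \<open>Normal forms\<close>

definition r_eval :: "'k::field poly \<Rightarrow> 'k U1" where
  "r_eval f = fold_coeffs (\<lambda>a s. a *\<^sub>U 1 + r1 * s) f 0"

lemma r_eval_0 [simp]: "r_eval 0 = 0"
  by (simp add: r_eval_def)

lemma r_eval_pCons [simp]: "r_eval (pCons a f) = a *\<^sub>U 1 + r1 * r_eval f"
  by (cases "a = 0 \<and> f = 0") (auto simp: r_eval_def)

lemma r_eval_add: "r_eval (f + g) = r_eval f + r_eval g"
  by (induction f g rule: poly_induct2) (simp_all add: U1.scale_left_distrib algebra_simps)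

lemma r_eval_smult: "r_eval (smult c f) = c *\<^sub>U r_eval f"
  by (induction f) (simp_all add: U1.scale_right_distrib scale_U1_mult_right)

lemma l1_r1: "l1 * r1 = r1 * l1 - r1 * (r1 :: 'k::field U1)"
  by (simp add: r1_l1 power2_eq_square)

lemma r_eval_uminus: "r_eval (- f) = - r_eval f"
  using r_eval_add[of f "- f"] by (simp add: add_eq_0_iff)

lemma r_eval_diff: "r_eval (f - g) = r_eval f - r_eval g"
  using r_eval_add[of f "- g"] by (simp add: r_eval_uminus)

lemma l1_r_eval: "l1 * r_eval f = r_eval f * l1 + r_eval (r_deriv f)"
proof (induction f)
  case (pCons a f)
  have "l1 * (r1 * r_eval f) = r1 * (l1 * r_eval f) - r1 * (r1 * r_eval f)"
    by (simp only: mult.assoc[symmetric] l1_r1 left_diff_distrib)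
  then show ?case
    by (simp add: distrib_left distrib_right scale_U1_mult_left scale_U1_mult_right pCons.IH
        r_eval_diff mult.assoc right_diff_distrib)
qed simp

lemma r_eval_in_R1: "r_eval f \<in> R1"
proof -
  have "r_eval f \<in> S" if S: "unital_subalgebra scale_U1 S" "{r1} \<subseteq> S" for S
  proof (induction f)
    case 0
    \<comment> \<open>Zero belongs to \<open>S\<close> as the zero multiple of 1.\<close>
    have "0 *\<^sub>U (1 :: 'a U1) \<in> S" using S(1) unfolding unital_subalgebra_def by blast
    then show ?case by simp
  next
    case (pCons a f)
    with S show ?case by (simp add: unital_subalgebra_def)
  qed
  then show ?thesis by (auto simp: R1_def hull_def)
qed

text \<open>Horner's scheme with \<open>l1\<close> on the right keeps the coefficients from K[r1] to
  the left of the powers of \<open>l1\<close>.\<close>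

definition eval_nf :: "'k::field poly poly \<Rightarrow> 'k U1" where
  "eval_nf p = fold_coeffs (\<lambda>f s. r_eval f + s * l1) p 0"

lemma eval_nf_0 [simp]: "eval_nf 0 = 0"
  by (simp add: eval_nf_def)

lemma eval_nf_pCons [simp]: "eval_nf (pCons f p) = r_eval f + eval_nf p * l1"
  by (cases "f = 0 \<and> p = 0") (auto simp: eval_nf_def)

lemma eval_nf_add: "eval_nf (p + q) = eval_nf p + eval_nf q"
  by (induction p q rule: poly_induct2) (simp_all add: r_eval_add algebra_simps)

lemma eval_nf_scale: "eval_nf (smult [:c:] p) = c *\<^sub>U eval_nf p"
  by (induction p) (simp_all add: r_eval_smult U1.scale_right_distrib scale_U1_mult_left)

lemma eval_nf_r_op: "eval_nf (r_op p) = r1 * eval_nf p"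
  by (induction p) (simp_all add: r_op_def distrib_left mult.assoc)

lemma eval_nf_l_op: "eval_nf (l_op p) = l1 * eval_nf p"
proof (induction p)
  case (pCons f p)
  have "l_op (pCons f p) = [:0, f:] + pCons (r_deriv f) (l_op p)"
    by (simp add: l_op_def map_poly_pCons)
  then show ?case
    by (simp add: eval_nf_add pCons.IH distrib_left distrib_right l1_r_eval mult.assoc
        add.assoc del: add_pCons)
qed simp

text \<open>It suffices to check generators, where this is \<open>eval_nf_l_op\<close> and
  \<open>eval_nf_r_op\<close>. At \<open>p = 1\<close> it shows that every element has a normal
  form.\<close>

lemma mult_eval_nf: "u * eval_nf p = eval_nf (act u p)"
proof (induction u arbitrary: p rule: U1_induct)
  case (mult u v)
  then show ?case by (simp add: act_mult mult.assoc)
qed (simp_all add: act_l1 act_r1 act_add_left act_scale eval_nf_l_op eval_nf_r_op eval_nf_add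
    eval_nf_scale distrib_right scale_U1_mult_left)

definition nf :: "'k::field U1 \<Rightarrow> 'k poly poly" where
  "nf u = act u 1"

lemma eval_nf_nf [simp]: "eval_nf (nf u) = u"
  using mult_eval_nf[of u 1] by (simp add: nf_def one_pCons)

lemma nf_inject: "nf u = nf v \<longleftrightarrow> u = v"
  by (metis eval_nf_nf)

lemma nf_mult: "nf (u * v) = act u (nf v)"
  by (simp add: nf_def act_mult)

lemma act_r_eval: "act (r_eval f) q = smult f q"
  by (induction f) (simp_all add: act_add_left act_scale act_mult act_r1 r_op_def
      smult_add_left[symmetric])

lemma act_eval_nf_pCons: "act (eval_nf (pCons f p)) q = smult f q + act (eval_nf p) (l_op q)"
  by (simp add: act_add_left act_mult act_r_eval act_l1)

section \<open>Additivity of the degree in \<open>l1\<close>\<close>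

lemma degree_l_op: "degree (l_op q) = Suc (degree q)" if "q \<noteq> 0"
proof (rule antisym)
  show "degree (l_op q) \<le> Suc (degree q)"
    by (rule degree_le) (auto simp: coeff_l_op coeff_pCons coeff_eq_0 split: nat.split)
  show "Suc (degree q) \<le> degree (l_op q)"
    using that by (intro le_degree) (simp add: coeff_l_op coeff_eq_0)
qed

text \<open>Each \<open>l_op\<close> raises the degree by exactly one, so the highest power of
  \<open>l1\<close> dominates; its contribution cannot vanish because K[x] is a domain.\<close>

lemma degree_act_eval_nf:
  "degree (act (eval_nf p) q) = degree p + degree q" if "p \<noteq> 0" "q \<noteq> 0"
  using that
proof (induction p arbitrary: q)
  case (pCons f p)
  show ?case
  proof (cases "p = 0")
    case True
    with pCons show ?thesis by (simp add: act_r_eval)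
  next
    case False
    have l: "l_op q \<noteq> 0" using degree_l_op[OF pCons.prems(2)] by auto
    have "degree (act (eval_nf p) (l_op q)) = degree p + Suc (degree q)"
      using pCons.IH[OF False l] degree_l_op[OF pCons.prems(2)] by simp
    moreover have "degree (smult f q) \<le> degree q" by (rule degree_smult_le)
    ultimately show ?thesis
      using False unfolding act_eval_nf_pCons by (subst degree_add_eq_right) auto
  qed
qed simp

lemma degree_nf_mult: "degree (nf (u * v)) = degree (nf u) + degree (nf v)" if "u \<noteq> 0" "v \<noteq> 0"
proof -
  have "nf u \<noteq> 0" "nf v \<noteq> 0" using that by (metis eval_nf_0 eval_nf_nf)+
  then show ?thesis using degree_act_eval_nf[of "nf u" "nf v"] by (simp add: nf_mult)
qed

lemma degree_nf_0E:
  assumes "degree (nf u) = 0"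
  obtains f where "u = r_eval f" "nf u = [:f:]"
proof -
  obtain f where f: "nf u = [:f:]" using assms by (meson degree_eq_zeroE)
  then have "u = r_eval f" using eval_nf_nf[of u] by simp
  with f that show thesis by blast
qed

section \<open>The embedded polynomial ring, units and cancellation\<close>

lemma nf_r_eval: "nf (r_eval f) = [:f:]"
  by (simp add: nf_def act_r_eval one_pCons)

lemma r_eval_inject: "r_eval f = r_eval g \<longleftrightarrow> f = g"
proof
  assume "r_eval f = r_eval g"
  then have "nf (r_eval f) = nf (r_eval g)" by (rule arg_cong)
  then show "f = g" by (simp only: nf_r_eval pCons_eq_iff)
qed simp

lemma r_eval_mult: "r_eval (f * g) = r_eval f * r_eval g"
proof -
  have "nf (r_eval (f * g)) = nf (r_eval f * r_eval g)"
    by (simp add: nf_mult nf_r_eval act_r_eval)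
  then show ?thesis by (simp only: nf_inject)
qed

lemma r1_eq_r_eval: "r1 = r_eval [:0, 1:]"
  by simp

text \<open>Additivity puts both factors in degree 0, that is, in K[r1], whose units are the nonzero
  constants.\<close>

lemma mult_eq_1_imp_scalar:
  fixes u v :: "'k::field U1"
  assumes "u * v = 1"
  obtains c where "u = c *\<^sub>U 1"
proof -
  have nz: "u \<noteq> 0" "v \<noteq> 0" using assms by auto
  have "nf (1 :: 'k U1) = 1" by (simp add: nf_def)
  then have "degree (nf u) = 0" "degree (nf v) = 0"
    using degree_nf_mult[OF nz] by (simp_all add: assms)
  then obtain f g where fg: "u = r_eval f" "v = r_eval g"
    by (metis degree_nf_0E)
  have "r_eval (f * g) = r_eval 1"
    using assms fg by (simp add: r_eval_mult one_pCons)
  then have "f * g = 1" by (simp only: r_eval_inject)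
  then have "f dvd 1" by (metis dvd_triv_left)
  then obtain c where "f = [:c:]" by (auto simp: is_unit_poly_iff)
  with fg that show thesis by simp
qed

lemma r1_mult_cancel: "r1 * u = r1 * v \<longleftrightarrow> u = v"
proof
  assume "r1 * u = r1 * v"
  then have "r_op (nf u) = r_op (nf v)" by (metis nf_mult act_r1)
  then have "smult [:0, 1:] (nf u - nf v) = 0" by (simp add: r_op_def smult_diff_right)
  then have "nf u = nf v" by simp
  then show "u = v" by (simp only: nf_inject)
qed simp


section \<open>The centralizer of \<open>r\<^sub>1\<close>\<close>

lemma act_eval_nf_sum:
  "act (eval_nf p) q = (\<Sum>j\<le>degree p. smult (coeff p j) ((l_op ^^ j) q))"
proof (induction p arbitrary: q)
  case (pCons f p)
  show ?case
  proof (cases "p = 0")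
    case True
    then show ?thesis by (simp add: act_r_eval)
  next
    case False
    then show ?thesis
      unfolding act_eval_nf_pCons pCons.IH
      by (simp add: sum.atMost_Suc_shift funpow_swap1 del: sum.atMost_Suc funpow.simps(2))
        (simp add: funpow_swap1)
  qed
qed simp

lemma coeff_l_op_pow_gt: "j < n \<Longrightarrow> coeff ((l_op ^^ j) [:f:]) n = 0"
proof (induction j arbitrary: n)
  case 0
  then show ?case by (cases n) simp_all
next
  case (Suc j)
  then obtain m where "n = Suc m" "j < m" by (cases n) auto
  with Suc.IH[of m] Suc.IH[of n] show ?case by (simp add: coeff_l_op)
qed

lemma coeff_l_op_pow_same: "coeff ((l_op ^^ j) [:f:]) j = f"
  by (induction j) (simp_all add: coeff_l_op coeff_l_op_pow_gt)

text \<open>In l1^(j+1) f = sum_i binom(j+1, i) D^(j+1-i)(f) l1^i, with D = \<open>r_deriv\<close>,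
  this is the term i = j.\<close>

lemma coeff_l_op_pow_Suc:
  "coeff ((l_op ^^ Suc j) [:f:]) j = smult (of_nat (Suc j)) (r_deriv f)"
proof (induction j)
  case 0
  show ?case by (simp add: coeff_l_op)
next
  case (Suc j)
  have "coeff ((l_op ^^ Suc (Suc j)) [:f:]) (Suc j) =
      coeff ((l_op ^^ Suc j) [:f:]) j + r_deriv (coeff ((l_op ^^ Suc j) [:f:]) (Suc j))"
    by (simp add: coeff_l_op)
  also have "\<dots> = smult (of_nat (Suc j) + 1) (r_deriv f)"
    unfolding Suc.IH coeff_l_op_pow_same by (simp add: smult_add_left del: of_nat_Suc)
  finally show ?case by (simp add: add.commute)
qed

lemma centralizer_r1:
  fixes u :: "'k::field_char_0 U1"
  assumes "r1 * u = u * r1"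
  obtains f where "u = r_eval f"
proof (cases "degree (nf u)")
  case 0
  then show thesis using that by (metis degree_nf_0E)
next
  case (Suc n)
  let ?p = "nf u" and ?x = "[:[:0, 1:]:] :: 'k poly poly"
  \<comment> \<open>The two sides are the normal forms of r1 u and u r1.\<close>
  have "r_op ?p = act u ?x"
    by (metis act_r1 assms nf_mult nf_r_eval r1_eq_r_eval)
  then have "r_op ?p = (\<Sum>j\<le>degree ?p. smult (coeff ?p j) ((l_op ^^ j) ?x))"
    using act_eval_nf_sum[of ?p ?x] by simp
  \<comment> \<open>The index n lies one below the degree, so only the terms j = n and j = n + 1
    survive.\<close>
  then have "coeff (r_op ?p) n = (\<Sum>j\<le>Suc n. coeff ?p j * coeff ((l_op ^^ j) ?x) n)"
    by (simp add: Suc coeff_sum del: sum.atMost_Suc)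
  also have "\<dots> = (\<Sum>j<n. coeff ?p j * coeff ((l_op ^^ j) ?x) n)
      + coeff ?p n * coeff ((l_op ^^ n) ?x) n + coeff ?p (Suc n) * coeff ((l_op ^^ Suc n) ?x) n"
    by (simp add: lessThan_Suc_atMost[symmetric] del: funpow.simps)
  also have "\<dots> = coeff ?p n * [:0, 1:]
      + coeff ?p (Suc n) * smult (of_nat (Suc n)) (r_deriv [:0, 1:])"
    by (simp add: coeff_l_op_pow_gt coeff_l_op_pow_same coeff_l_op_pow_Suc
        del: funpow.simps of_nat_Suc r_deriv_simps)
  \<comment> \<open>The summands x p_n cancel, leaving (n + 1) x^2 p_{n+1} = 0; in characteristic 0
    this kills the leading coefficient.\<close>
  finally have "coeff ?p (Suc n) = 0"
    by (simp add: r_op_def mult.commute del: of_nat_Suc)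
  with Suc have "?p = 0" by (metis leading_coeff_0_iff)
  with Suc show thesis by simp
qed


section \<open>The commutator ideal\<close>

lemma r1_sq_normal: "\<exists>v. u * (r1 * r1) = r1 * (r1 * v)"
proof (induction u rule: U1_induct)
  case one
  show ?case by (metis mult_1_left mult_1_right)
next
  case l1
  \<comment> \<open>Moving \<open>l1\<close> past r1^2 costs \<open>r_deriv\<close> of x^2, which is
    -2 x^3.\<close>
  have "l1 * (r1 * r1) = r1 * (r1 * (l1 - r1 - r1))"
    by (simp add: mult.assoc[symmetric] l1_r1 left_diff_distrib right_diff_distrib)
      (simp add: mult.assoc l1_r1 right_diff_distrib)
  then show ?case ..
next
  case r1
  show ?case by blast
next
  case (add u v)
  then obtain a b where "u * (r1 * r1) = r1 * (r1 * a)" "v * (r1 * r1) = r1 * (r1 * b)" by blast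
  then have "(u + v) * (r1 * r1) = r1 * (r1 * (a + b))" by (simp only: distrib_left distrib_right)
  then show ?case ..
next
  case (mult u v)
  then obtain a b where a: "u * (r1 * r1) = r1 * (r1 * a)" and b: "v * (r1 * r1) = r1 * (r1 * b)"
    by blast
  have "u * v * (r1 * r1) = u * (r1 * r1) * b" by (simp only: mult.assoc b)
  also have "\<dots> = r1 * (r1 * (a * b))" by (simp only: a) (simp only: mult.assoc)
  finally show ?case ..
next
  case (scale c u)
  then obtain a where "u * (r1 * r1) = r1 * (r1 * a)" by blast
  then have "(c *\<^sub>U u) * (r1 * r1) = r1 * (r1 * (c *\<^sub>U a))"
    by (simp only: scale_U1_mult_left scale_U1_mult_right)
  then show ?case ..
qed

definition r_sq_ideal :: "'k::field U1 set" where
  "r_sq_ideal = range (\<lambda>v. r1 * (r1 * v))"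

lemma r_sq_idealI: "r1 * (r1 * v) \<in> r_sq_ideal"
  by (simp add: r_sq_ideal_def)

lemma r_sq_idealE:
  assumes "u \<in> r_sq_ideal"
  obtains v where "u = r1 * (r1 * v)"
  using assms by (auto simp: r_sq_ideal_def)

lemma r_sq_ideal_add: "u \<in> r_sq_ideal \<Longrightarrow> v \<in> r_sq_ideal \<Longrightarrow> u + v \<in> r_sq_ideal"
  by (elim r_sq_idealE) (simp only: distrib_left[symmetric] r_sq_idealI)

lemma r_sq_ideal_mult_right: "u \<in> r_sq_ideal \<Longrightarrow> u * w \<in> r_sq_ideal"
  by (elim r_sq_idealE) (simp only: mult.assoc r_sq_idealI)

text \<open>Normality of r1^2 makes the right ideal r1^2 U1 two-sided.\<close>

lemma r_sq_ideal_mult_left: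
  assumes "u \<in> r_sq_ideal"
  shows "w * u \<in> r_sq_ideal"
proof -
  obtain v where v: "u = r1 * (r1 * v)" using assms by (rule r_sq_idealE)
  obtain a where a: "w * (r1 * r1) = r1 * (r1 * a)" using r1_sq_normal by blast
  have "w * u = w * (r1 * r1) * v" by (simp only: v mult.assoc)
  then show ?thesis by (simp only: a) (simp only: mult.assoc r_sq_idealI)
qed

lemma r_sq_ideal_scale: "u \<in> r_sq_ideal \<Longrightarrow> c *\<^sub>U u \<in> r_sq_ideal"
  using r_sq_ideal_mult_right[of u "c *\<^sub>U 1"] by (simp add: scale_U1_mult_right)

lemma r_sq_ideal_0: "0 \<in> r_sq_ideal"
  using r_sq_idealI[of 0] by simp

text \<open>Modulo the ideal the generators commute, since r1 l1 - l1 r1 = r1^2, and the elements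
  commuting with a fixed v form a subalgebra.\<close>

lemma commutator_in_r_sq_ideal: "u * v - v * u \<in> r_sq_ideal"
proof -
  define C :: "'a U1 \<Rightarrow> 'a U1 \<Rightarrow> bool" where "C u v \<longleftrightarrow> u * v - v * u \<in> r_sq_ideal" for u v
  have sym: "C v u" if "C u v" for u v
    using r_sq_ideal_mult_left[of "u * v - v * u" "- 1"] that by (simp add: C_def)
  have refl: "C u u" for u by (simp add: C_def r_sq_ideal_0)
  have gen: "C u v" if "C l1 v" "C r1 v" for u v
  proof (induction u rule: U1_induct)
    case (add u w)
    then show ?case
      using r_sq_ideal_add[of "u * v - v * u" "w * v - v * w"] by (simp add: C_def algebra_simps)
  next
    case (mult u w)
    then have "u * (w * v - v * w) + (u * v - v * u) * w \<in> r_sq_ideal"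
      by (simp add: C_def r_sq_ideal_add r_sq_ideal_mult_left r_sq_ideal_mult_right)
    then show ?case by (simp add: C_def algebra_simps)
  next
    case (scale c u)
    then show ?case
      using r_sq_ideal_scale[of "u * v - v * u" c]
      by (simp add: C_def U1.scale_right_diff_distrib scale_U1_mult_left scale_U1_mult_right)
  qed (use that in \<open>simp_all add: C_def r_sq_ideal_0\<close>)
  have "C r1 l1" using r_sq_idealI[of 1] by (simp add: C_def r1_l1 power2_eq_square)
  \<comment> \<open>\<open>gen\<close> is first used with a generator as second argument and the
    result turned around by \<open>sym\<close>; its next use frees both arguments.\<close>
  then have "C l1 v" "C r1 v" for v using gen sym refl by blast+
  then have "C u v" using gen by blast
  then show ?thesis by (simp add: C_def)
qed


section \<open>Automorphisms\<close>

theorem theorem5: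
  fixes \<phi> :: "'k::field_char_0 U1 \<Rightarrow> 'k U1"
  assumes "algebra_automorphism scale_U1 \<phi>"
  shows "\<exists>\<alpha>::'k. \<exists>h\<in>R1. \<alpha> \<noteq> 0 \<and> \<phi> l1 = \<alpha> *\<^sub>U l1 + h \<and> \<phi> r1 = \<alpha> *\<^sub>U r1"
proof -
  interpret \<phi>: Vector_Spaces.linear scale_U1 scale_U1 \<phi>
    using assms unfolding algebra_automorphism_def by blast
  have bij: "bij \<phi>" and mult: "\<phi> (x * y) = \<phi> x * \<phi> y" for x y
    using assms unfolding algebra_automorphism_def by blast+
  have rl: "r1 * l1 - l1 * r1 = r1 * (r1 :: 'k U1)"
    by (simp add: r1_l1 power2_eq_square)

  have "\<phi> r1 * \<phi> r1 = \<phi> r1 * \<phi> l1 - \<phi> l1 * \<phi> r1"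
    by (metis rl mult \<phi>.diff)
  then have "\<phi> r1 * \<phi> r1 \<in> r_sq_ideal" by (simp add: commutator_in_r_sq_ideal)
  then obtain u where u: "\<phi> r1 * \<phi> r1 = r1 * (r1 * u)" by (auto simp: r_sq_ideal_def)

  \<comment> \<open>The preimages stand in for the inverse automorphism: [a, b] = r1^2 w is mapped
    to r1^2, so r1^2 = \<phi>(r1)^2 \<phi>(w) = r1^2 u \<phi>(w).\<close>
  obtain a b where ab: "\<phi> a = r1" "\<phi> b = l1" using bij by (metis bij_pointE)
  have "\<phi> (a * b - b * a) = r1 * r1" by (simp add: \<phi>.diff mult ab rl)
  moreover obtain w where "a * b - b * a = r1 * (r1 * w)"
    using commutator_in_r_sq_ideal[of a b] by (auto simp: r_sq_ideal_def)
  ultimately have "r1 * (r1 * 1) = r1 * (r1 * (u * \<phi> w))"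
    using u by (simp add: mult mult.assoc[symmetric])
  then have "u * \<phi> w = 1" by (simp only: r1_mult_cancel)
  then obtain c where c: "u = c *\<^sub>U 1" by (rule mult_eq_1_imp_scalar)

  have nz: "\<phi> r1 \<noteq> 0"
  proof
    assume "\<phi> r1 = 0"
    then have "\<phi> r1 = \<phi> 0" by simp
    then have "r1 = (0 :: 'k U1)" by (rule injD[OF bij_is_inj[OF bij]])
    then have "r_eval [:0, 1 :: 'k:] = r_eval 0" by simp
    then show False by (simp only: r_eval_inject) simp
  qed
  have sq: "\<phi> r1 * \<phi> r1 = r_eval [:0, 0, c:]"
    by (simp add: u c)
  then have "degree (nf (\<phi> r1)) = 0"
    using degree_nf_mult[OF nz nz] nf_r_eval[of "[:0, 0, c:]"] by simp
  then obtain f where f: "\<phi> r1 = r_eval f" by (rule degree_nf_0E)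
  then have "f * f = [:0, 0, c:]" using sq by (simp only: r_eval_mult[symmetric] r_eval_inject)
  \<comment> \<open>This excludes c = 0, so f^2 has degree exactly 2.\<close>
  moreover have "f \<noteq> 0" using nz f by auto
  ultimately have "degree f = 1" and ff: "f * f = [:0, 0, c:]"
    using degree_mult_eq[of f f] by (auto split: if_splits)
  then obtain a \<alpha> where "f = [:a, \<alpha>:]" "\<alpha> \<noteq> 0" by (metis degree1_coeffs)
  moreover from this have "a = 0" using ff by simp
  ultimately have \<alpha>: "f = [:0, \<alpha>:]" "\<alpha> \<noteq> 0" by simp_all
  then have r: "\<phi> r1 = \<alpha> *\<^sub>U r1" using f by (simp add: scale_U1_mult_right)

  \<comment> \<open>\<open>m\<close> will commute with \<open>r1\<close>: cancelling one factor
    \<alpha> from the image of the relation gives [r1, \<phi>(l1)] = \<alpha> r1^2 = \<alpha>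
    [r1, l1].\<close>
  define m where "m = \<phi> l1 - \<alpha> *\<^sub>U l1"
  have "\<phi> (r1 * l1 - l1 * r1) = \<phi> (r1 * r1)" by (simp only: rl)
  then have "\<alpha> *\<^sub>U (r1 * \<phi> l1 - \<phi> l1 * r1) = \<alpha> *\<^sub>U \<alpha> *\<^sub>U (r1 * r1)"
    by (simp add: \<phi>.diff mult r scale_U1_mult_left scale_U1_mult_right U1.scale_right_diff_distrib)
  then have "r1 * \<phi> l1 - \<phi> l1 * r1 = \<alpha> *\<^sub>U (r1 * l1 - l1 * r1)"
    using \<alpha>(2) by (simp only: U1.scale_cancel_left rl) simp
  then have "r1 * m = m * r1"
    by (simp add: m_def algebra_simps scale_U1_mult_left scale_U1_mult_right
        U1.scale_right_diff_distrib)
  then obtain h where "m = r_eval h" by (rule centralizer_r1)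
  then have "\<phi> l1 = \<alpha> *\<^sub>U l1 + r_eval h" by (simp add: m_def algebra_simps)
  then show ?thesis using r \<alpha>(2) r_eval_in_R1 by blast
qed

end
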